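(* Assume authenticated channels with honest sign-once. Then no certificate $\mathrm{Cert}(h^\star)$ of size at least $2f+1$ can carry two (counted) valid signatures from the same agent. In particular, $\mathrm{Cert}(h^\star)$ witnesses at least $f+1$ honest signers on the digest $h^\star$.
   Context: There are $n\ge 3f+1$ agents, at most $f$ of which are Byzantine; the others are honest. A certificate $\mathrm{Cert}(h^\star)$ over a digest $h^\star$ is a set $\Sigma$ of pairs (signer identity, valid signature of that identity on $h^\star$), in which per-signer uniqueness is enforced: at most one signature per signer identity is counted (duplicates are discarded), and its size is the number of distinct signer identities. Authenticated channels and honest sign-once: signatures of honest agents are unforgeable, and in each round an honest agent signs at most one digest. A Byzantine identity may sign several distinct digests. *)

theory Defs
  imports Main
begin

text \<open>
  Conventions: \<open>'a\<close> are agent identities, \<open>'d\<close> digests, \<open>'s\<close> the signatures that occur in an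
  execution.  \<open>valid a h s\<close> means that \<open>s\<close> verifies as a signature of \<open>a\<close> on the digest \<open>h\<close>;
  \<open>signs r a h\<close> means that in round \<open>r\<close> the agent \<open>a\<close> itself signed \<open>h\<close>.  Nothing below
  constrains \<open>valid\<close> or \<open>signs\<close> for a Byzantine agent.
\<close>

definition unforgeable ::
  "'a set \<Rightarrow> ('a \<Rightarrow> 'd \<Rightarrow> 's \<Rightarrow> bool) \<Rightarrow> (nat \<Rightarrow> 'a \<Rightarrow> 'd \<Rightarrow> bool) \<Rightarrow> bool" where
  "unforgeable honest valid signs \<longleftrightarrow>
     (\<forall>a\<in>honest. \<forall>h s. valid a h s \<longrightarrow> (\<exists>r. signs r a h))"

definition sign_once :: "'a set \<Rightarrow> (nat \<Rightarrow> 'a \<Rightarrow> 'd \<Rightarrow> bool) \<Rightarrow> bool" where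
  "sign_once honest signs \<longleftrightarrow>
     (\<forall>a\<in>honest. \<forall>r h h'. signs r a h \<longrightarrow> signs r a h' \<longrightarrow> h = h')"

text \<open>
  Enforcement of per-signer uniqueness.  The pairs of \<open>\<Sigma>\<close> are inspected one at a time in an
  arbitrary order; a pair is counted unless its signer is already represented among the counted
  pairs, in which case it is discarded.  \<open>tally \<Sigma> C\<close> says that \<open>C\<close> is a possible set of counted
  pairs, so which of several signatures of one signer survives is left open.
\<close>

inductive tally :: "('a \<times> 's) set \<Rightarrow> ('a \<times> 's) set \<Rightarrow> bool" where
  empty: "tally {} {}"
| count: "tally \<Sigma> C \<Longrightarrow> a \<notin> fst ` C \<Longrightarrow> tally (insert (a, s) \<Sigma>) (insert (a, s) C)"
| discard: "tally \<Sigma> C \<Longrightarrow> a \<in> fst ` C \<Longrightarrow> tally (insert (a, s) \<Sigma>) C"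

text \<open>A certificate over \<open>h\<close>, with submitted pairs \<open>\<Sigma>\<close> and counted pairs \<open>C\<close>.\<close>

definition certificate ::
  "'a set \<Rightarrow> ('a \<Rightarrow> 'd \<Rightarrow> 's \<Rightarrow> bool) \<Rightarrow> 'd \<Rightarrow> ('a \<times> 's) set \<Rightarrow> ('a \<times> 's) set \<Rightarrow> bool" where
  "certificate agents valid h \<Sigma> C \<longleftrightarrow>
     (\<forall>(a, s)\<in>\<Sigma>. a \<in> agents \<and> valid a h s) \<and> tally \<Sigma> C"

definition cert_size :: "('a \<times> 's) set \<Rightarrow> nat" where
  "cert_size \<Sigma> = card (fst ` \<Sigma>)"

end

theory Submission
  imports Defs
begin

text \<open>Counting admits a signer only if not yet represented, so \<open>fst\<close> is injective
  on \<open>C\<close> (\<open>tally_inj_on\<close>); this excludes double counting even for a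
  Byzantine signer with several valid signatures. Discarding never loses a signer
  (\<open>tally_signers\<close>), so \<open>C\<close> still has at least 2f+1 signers. At most f are
  Byzantine, and each of the remaining f+1 or more must itself have signed \<open>h\<close>, by
  unforgeability.\<close>

lemma tally_subset: "tally \<Sigma> C \<Longrightarrow> C \<subseteq> \<Sigma>"
  by (induction rule: tally.induct) auto

text \<open>A pair is discarded only when its signer is already counted. This carries the bound on
  \<open>cert_size \<Sigma>\<close> over to \<open>C\<close>, whichever signatures survive.\<close>

lemma tally_signers: "tally \<Sigma> C \<Longrightarrow> fst ` C = fst ` \<Sigma>"
  by (induction rule: tally.induct) auto

lemma tally_inj_on: "tally \<Sigma> C \<Longrightarrow> inj_on fst C"
  by (induction rule: tally.induct) (auto simp: inj_on_insert)

theorem lemma5p2: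
  fixes agents byz :: "'a set" and n f :: nat
    and valid :: "'a \<Rightarrow> 'd \<Rightarrow> 's \<Rightarrow> bool"
    and signs :: "nat \<Rightarrow> 'a \<Rightarrow> 'd \<Rightarrow> bool"
    and h :: 'd and \<Sigma> C :: "('a \<times> 's) set"
  assumes "finite agents" and "card agents = n" and "n \<ge> 3 * f + 1"
    and "byz \<subseteq> agents" and "card byz \<le> f"
    and "unforgeable (agents - byz) valid signs"
    and "sign_once (agents - byz) signs"
    and "certificate agents valid h \<Sigma> C"
    and "cert_size \<Sigma> \<ge> 2 * f + 1"
  shows "\<not> (\<exists>a s s'. s \<noteq> s' \<and> (a, s) \<in> C \<and> (a, s') \<in> C)
       \<and> card {a \<in> fst ` C. a \<in> agents - byz \<and> (\<exists>r. signs r a h)} \<ge> f + 1"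
proof
  have valid: "a \<in> agents \<and> valid a h s" if "(a, s) \<in> \<Sigma>" for a s
    using assms(8) that unfolding certificate_def by auto
  have tally: "tally \<Sigma> C"
    using assms(8) unfolding certificate_def by blast
  show "\<not> (\<exists>a s s'. s \<noteq> s' \<and> (a, s) \<in> C \<and> (a, s') \<in> C)"
    using tally_inj_on[OF tally] by (force simp: inj_on_def)
  have signers: "fst ` C \<subseteq> agents"
    using valid tally_subset[OF tally] by auto
  have "2 * f + 1 \<le> card (fst ` C)"
    using assms(9) tally_signers[OF tally] unfolding cert_size_def by simp
  \<comment> \<open>Finiteness of \<open>byz\<close>, inherited from \<open>agents\<close>, is what
    the cardinality bound for a set difference requires.\<close>
  moreover have "card (fst ` C) - card byz \<le> card (fst ` C - byz)"
    using assms(1,4) by (intro diff_card_le_card_Diff) (rule finite_subset)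
  ultimately have "f + 1 \<le> card (fst ` C - byz)"
    using assms(5) by linarith
  also have "\<dots> \<le> card {a \<in> fst ` C. a \<in> agents - byz \<and> (\<exists>r. signs r a h)}"
  \<comment> \<open>Finiteness of the larger set matters: an infinite set would have
    \<open>card\<close> 0.\<close>
  proof (rule card_mono)
    show "finite {a \<in> fst ` C. a \<in> agents - byz \<and> (\<exists>r. signs r a h)}"
      using finite_subset[OF signers assms(1)] by simp
    show "fst ` C - byz \<subseteq> {a \<in> fst ` C. a \<in> agents - byz \<and> (\<exists>r. signs r a h)}"
    proof
      fix a assume a: "a \<in> fst ` C - byz"
      then obtain s where "(a, s) \<in> C" by auto
      then have "valid a h s"
        using valid tally_subset[OF tally] by blast
      moreover have "a \<in> agents - byz"
        using a signers by auto
      \<comment> \<open>Unforgeability turns the valid signature \<open>s\<close> of the honest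
        \<open>a\<close> into a round in which \<open>a\<close> signed \<open>h\<close>.\<close>
      ultimately show "a \<in> {a \<in> fst ` C. a \<in> agents - byz \<and> (\<exists>r. signs r a h)}"
        using a assms(6) unfolding unforgeable_def by blast
    qed
  qed
  finally show "card {a \<in> fst ` C. a \<in> agents - byz \<and> (\<exists>r. signs r a h)} \<ge> f + 1" .
qed

end
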